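(* A countably based $T_0$-space $X$ is sober if and only if it does not contain a $\mathbf{\Pi}^0_2$-subspace homeomorphic to $S_D$ or $S_1$.
   Context: Countably based means second countable. For a topological space $X$, $\mathbf{\Sigma}^0_2(X)$ is the set of all subsets of the form $\bigcup_{i\in\omega}U_i\setminus V_i$ with $U_i,V_i\subseteq X$ open, and $\mathbf{\Pi}^0_2(X)$ is the set of complements of members of $\mathbf{\Sigma}^0_2(X)$; a $\mathbf{\Pi}^0_2$-subspace of $X$ is a member of $\mathbf{\Pi}^0_2(X)$ with the subspace topology. A non-empty closed set is irreducible if it is not the union of two proper closed subsets. A space is sober if every irreducible closed set equals the closure of a unique point. $S_1$ is the set of natural numbers with the cofinite topology; $S_D$ is the set of natural numbers with the topology whose non-empty open sets are exactly the sets $\{m\in\omega : n\leq m\}$, $n\in\omega$. *)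

theory Defs
  imports "HOL-Analysis.Analysis"
begin

definition Sigma02 :: "'a topology \<Rightarrow> 'a set set" where
  "Sigma02 X =
     {\<Union>i. U i - V i | U V :: nat \<Rightarrow> 'a set. (\<forall>i. openin X (U i)) \<and> (\<forall>i. openin X (V i))}"

definition Pi02 :: "'a topology \<Rightarrow> 'a set set" where
  "Pi02 X = {topspace X - S | S. S \<in> Sigma02 X}"

definition irreducible_closedin :: "'a topology \<Rightarrow> 'a set \<Rightarrow> bool" where
  "irreducible_closedin X A \<longleftrightarrow>
     closedin X A \<and> A \<noteq> {} \<and>
     \<not> (\<exists>B C. closedin X B \<and> closedin X C \<and> B \<subset> A \<and> C \<subset> A \<and> A = B \<union> C)"

definition sober_space :: "'a topology \<Rightarrow> bool" where
  "sober_space X \<longleftrightarrow>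
     (\<forall>A. irreducible_closedin X A \<longrightarrow> (\<exists>!x. x \<in> topspace X \<and> A = X closure_of {x}))"

definition S1 :: "nat topology" where
  "S1 = topology (\<lambda>U. U = {} \<or> finite (- U))"

definition SD :: "nat topology" where
  "SD = topology (\<lambda>U. U = {} \<or> (\<exists>n. U = {m. n \<le> m}))"

lemma openin_S1: "openin S1 U \<longleftrightarrow> U = {} \<or> finite (- U)"
proof -
  have "istopology (\<lambda>U::nat set. U = {} \<or> finite (- U))"
    unfolding istopology_def
  proof (intro conjI allI impI)
    fix \<K> :: "nat set set"
    assume K: "\<forall>K\<in>\<K>. K = {} \<or> finite (- K)"
    show "\<Union>\<K> = {} \<or> finite (- \<Union>\<K>)"
    proof (cases "\<Union>\<K> = {}")
      case False
      then obtain K where "K \<in> \<K>" "K \<noteq> {}" by blast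
      with K have "finite (- K)" "- \<Union>\<K> \<subseteq> - K" by blast+
      then show ?thesis using finite_subset by blast
    qed simp
  qed auto
  then show ?thesis by (simp add: S1_def)
qed

lemma openin_SD: "openin SD U \<longleftrightarrow> U = {} \<or> (\<exists>n. U = {m. n \<le> m})"
proof -
  have "istopology (\<lambda>U::nat set. U = {} \<or> (\<exists>n. U = {m. n \<le> m}))"
    unfolding istopology_def
  proof (intro conjI allI impI)
    fix S T :: "nat set"
    assume "S = {} \<or> (\<exists>n. S = {m. n \<le> m})" "T = {} \<or> (\<exists>n. T = {m. n \<le> m})"
    moreover have "{m. a \<le> m} \<inter> {m. b \<le> m} = {m. max a b \<le> m}" for a b :: nat
      by auto
    ultimately show "S \<inter> T = {} \<or> (\<exists>n. S \<inter> T = {m. n \<le> m})"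
      by blast
  next
    fix \<K> :: "nat set set"
    assume K: "\<forall>K\<in>\<K>. K = {} \<or> (\<exists>n. K = {m. n \<le> m})"
    show "\<Union>\<K> = {} \<or> (\<exists>n. \<Union>\<K> = {m. n \<le> m})"
    proof (cases "\<Union>\<K> = {}")
      case False
      define n where "n = (LEAST k. k \<in> \<Union>\<K>)"
      have n: "n \<in> \<Union>\<K>"
        unfolding n_def using False by (metis LeastI equals0I)
      have least: "n \<le> m" if "m \<in> \<Union>\<K>" for m
        unfolding n_def using that by (rule Least_le)
      obtain K where "K \<in> \<K>" "n \<in> K" using n by blast
      with K obtain k where "K = {m. k \<le> m}" by blast
      with \<open>n \<in> K\<close> have "{m. n \<le> m} \<subseteq> K" by auto
      with \<open>K \<in> \<K>\<close> least have "\<Union>\<K> = {m. n \<le> m}" by blast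
      then show ?thesis by blast
    qed simp
  qed
  then show ?thesis by (simp add: SD_def)
qed

lemma topspace_S1: "topspace S1 = UNIV"
  by (metis openin_S1 Compl_UNIV_eq finite.emptyI openin_subset top.extremum_uniqueI)

lemma topspace_SD: "topspace SD = UNIV"
proof -
  have "openin SD UNIV" unfolding openin_SD by (auto intro: exI[of _ 0])
  then show ?thesis using openin_subset by blast
qed

end

theory Submission
  imports Defs "HOL-Library.Ramsey"
begin

text \<open>
  A \<open>\<Pi>\<^sup>0\<^sub>2\<close>-subspace of a sober space in which any two non-empty open sets meet has a generic
  point, namely that of its closure; the spaces \<open>SD\<close> and \<open>S1\<close> have none.
  Conversely, let \<open>C\<close> be an irreducible closed set without generic point.  Along a countable base,
  choose an infinite \<open>A \<subseteq> C\<close> that is almost contained in every open set meeting \<open>C\<close>.  Every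
  infinite subset of \<open>A\<close> inherits this property, and the property alone makes it \<open>\<Pi>\<^sup>0\<^sub>2\<close> and makes
  all point closures in it finite.  By Ramsey's theorem \<open>A\<close> contains an infinite chain or an infinite
  antichain of the specialization order; the first yields \<open>SD\<close> and the second \<open>S1\<close>.
\<close>

section \<open>The class \<open>Sigma02\<close>\<close>

lemma Sigma02_iff:
  "S \<in> Sigma02 X \<longleftrightarrow> (\<exists>U V :: nat \<Rightarrow> 'a set.
    S = (\<Union>i. U i - V i) \<and> (\<forall>i. openin X (U i)) \<and> (\<forall>i. openin X (V i)))"
  by (simp only: Sigma02_def mem_Collect_eq)

lemma Sigma02_Diff: "openin X U \<Longrightarrow> openin X V \<Longrightarrow> U - V \<in> Sigma02 X"
  unfolding Sigma02_def by (intro CollectI exI[of _ "\<lambda>_. U"] exI[of _ "\<lambda>_. V"]) auto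

lemma Sigma02_open: "openin X U \<Longrightarrow> U \<in> Sigma02 X"
  using Sigma02_Diff[of X U "{}"] by simp

lemma Sigma02_closed: "closedin X S \<Longrightarrow> S \<in> Sigma02 X"
  using Sigma02_Diff[of X "topspace X" "topspace X - S"]
  by (simp add: closedin_def double_diff)

text \<open>The sequences witnessing all the \<open>S n\<close> are chosen simultaneously; the
  resulting doubly indexed union becomes a single one by coding pairs of indices as natural
  numbers.\<close>

lemma Sigma02_UN_nat:
  fixes S :: "nat \<Rightarrow> 'a set"
  assumes "\<And>n. S n \<in> Sigma02 X"
  shows "(\<Union>n. S n) \<in> Sigma02 X"
proof -
  \<comment> \<open>Pairing the two sequences for each \<open>n\<close> lets one use of choice
    supply both.\<close>
  have "\<exists>P. \<forall>n. (\<forall>i. openin X (fst (P n) i)) \<and> (\<forall>i. openin X (snd (P n) i)) \<and>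
      S n = (\<Union>i::nat. fst (P n) i - snd (P n) i)"
  proof (rule choice, rule allI)
    fix n
    obtain U V where "S n = (\<Union>i::nat. U i - V i)" "\<forall>i. openin X (U i)" "\<forall>i. openin X (V i)"
      using assms[of n, unfolded Sigma02_iff] by (elim exE conjE)
    then show "\<exists>P. (\<forall>i. openin X (fst P i)) \<and> (\<forall>i. openin X (snd P i)) \<and>
        S n = (\<Union>i::nat. fst P i - snd P i)"
      by (intro exI[of _ "(U, V)"]) simp
  qed
  then obtain P where *: "\<forall>n. (\<forall>i. openin X (fst (P n) i)) \<and> (\<forall>i. openin X (snd (P n) i)) \<and>
      S n = (\<Union>i::nat. fst (P n) i - snd (P n) i)"
    by (elim exE)
  have P: "openin X (fst (P n) i)" "openin X (snd (P n) i)" for n i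
    using spec[OF *, of n] by simp_all
  have S: "S n = (\<Union>i. fst (P n) i - snd (P n) i)" for n
    using spec[OF *, of n] by (elim conjE)
  define U where "U k = (case prod_decode k of (n, i) \<Rightarrow> fst (P n) i)" for k
  define V where "V k = (case prod_decode k of (n, i) \<Rightarrow> snd (P n) i)" for k
  have "(\<Union>n. S n) = (\<Union>k. U k - V k)"
  proof (intro equalityI subsetI)
    fix x assume "x \<in> (\<Union>n. S n)"
    then obtain n where "x \<in> S n" by blast
    then obtain i where "x \<in> fst (P n) i - snd (P n) i" unfolding S by blast
    then have "x \<in> U (prod_encode (n, i)) - V (prod_encode (n, i))"
      unfolding U_def V_def by simp
    then show "x \<in> (\<Union>k. U k - V k)" by blast
  next
    fix x assume "x \<in> (\<Union>k. U k - V k)"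
    then obtain k where "x \<in> U k - V k" by blast
    moreover obtain n i where "prod_decode k = (n, i)" by fastforce
    ultimately have "x \<in> fst (P n) i - snd (P n) i" unfolding U_def V_def by simp
    then have "x \<in> S n" unfolding S by blast
    then show "x \<in> (\<Union>n. S n)" by blast
  qed
  moreover have "openin X (U k)" "openin X (V k)" for k
    using P unfolding U_def V_def by (simp_all split: prod.split)
  ultimately show ?thesis
    by (simp only: Sigma02_iff) (metis (full_types))
qed

text \<open>\<open>from_nat_into\<close> enumerates a non-empty countable set, with repetitions if
  it is finite. An empty index set has no enumeration and is treated separately.\<close>

lemma Sigma02_countable_UN:
  assumes "countable I" "\<And>i. i \<in> I \<Longrightarrow> S i \<in> Sigma02 X"
  shows "(\<Union>i\<in>I. S i) \<in> Sigma02 X"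
proof (cases "I = {}")
  case True
  then show ?thesis using Sigma02_open[OF openin_empty] by simp
next
  case False
  have "(\<Union>n. S (from_nat_into I n)) = \<Union>(S ` range (from_nat_into I))"
    by (simp only: image_image)
  also have "\<dots> = (\<Union>i\<in>I. S i)"
    by (simp only: range_from_nat_into[OF False assms(1)])
  finally have eq: "(\<Union>n. S (from_nat_into I n)) = (\<Union>i\<in>I. S i)" .
  have "(\<Union>n. S (from_nat_into I n)) \<in> Sigma02 X"
    by (rule Sigma02_UN_nat, rule assms(2), rule from_nat_into[OF False])
  then show ?thesis by (simp only: eq)
qed

lemma Sigma02_Un:
  assumes "S \<in> Sigma02 X" "T \<in> Sigma02 X"
  shows "S \<union> T \<in> Sigma02 X"
proof -
  have "(\<Union>R\<in>{S, T}. R) \<in> Sigma02 X"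
    using assms by (intro Sigma02_countable_UN) auto
  then show ?thesis by simp
qed

text \<open>An intersection of two differences of open sets is again such a difference, and
  intersection distributes over both unions.\<close>

lemma Sigma02_Int:
  assumes "S \<in> Sigma02 X" "T \<in> Sigma02 X"
  shows "S \<inter> T \<in> Sigma02 X"
proof -
  obtain U V where S: "S = (\<Union>i::nat. U i - V i)"
    and UV: "\<forall>i. openin X (U i)" "\<forall>i. openin X (V i)"
    using assms(1)[unfolded Sigma02_iff] by (elim exE conjE)
  obtain U' V' where T: "T = (\<Union>i::nat. U' i - V' i)"
    and UV': "\<forall>i. openin X (U' i)" "\<forall>i. openin X (V' i)"
    using assms(2)[unfolded Sigma02_iff] by (elim exE conjE)
  have "(U i - V i) \<inter> (U' j - V' j) = (U i \<inter> U' j) - (V i \<union> V' j)" for i j by blast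
  then have "(U i - V i) \<inter> (U' j - V' j) \<in> Sigma02 X" for i j
    using UV UV' by (simp add: Sigma02_Diff openin_Int openin_Un)
  then show ?thesis
    unfolding S T Int_UN_distrib2 by (intro Sigma02_UN_nat)
qed

text \<open>By the T0 axiom, \<open>y\<close> differs from \<open>x\<close> exactly when some basic
  open set contains one of them but not the other. The complement of \<open>x\<close> is thus a
  countable union of basic open sets missing \<open>x\<close> and of complements of basic open sets
  containing \<open>x\<close>.\<close>

lemma Sigma02_compl_singleton:
  assumes "second_countable X" "t0_space X" "x \<in> topspace X"
  shows "topspace X - {x} \<in> Sigma02 X"
proof -
  obtain \<B> where "countable \<B> \<and> (\<forall>V\<in>\<B>. openin X V) \<and>
      (\<forall>U y. openin X U \<and> y \<in> U \<longrightarrow> (\<exists>V\<in>\<B>. y \<in> V \<and> V \<subseteq> U))"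
    using assms(1) unfolding second_countable_def by (elim exE)
  then have B: "countable \<B>" "\<And>V. V \<in> \<B> \<Longrightarrow> openin X V"
    "\<And>U y. openin X U \<Longrightarrow> y \<in> U \<Longrightarrow> \<exists>V\<in>\<B>. y \<in> V \<and> V \<subseteq> U"
    by simp_all
  have "topspace X - {x} =
      (\<Union>V\<in>{V\<in>\<B>. x \<notin> V}. V) \<union> (\<Union>V\<in>{V\<in>\<B>. x \<in> V}. topspace X - V)" (is "_ = ?R")
  proof
    show "topspace X - {x} \<subseteq> ?R"
    proof
      fix y assume y: "y \<in> topspace X - {x}"
      then obtain U where U: "openin X U" "x \<notin> U \<longleftrightarrow> y \<in> U"
        using assms(2,3) unfolding t0_space_def by blast
      then obtain V where "V \<in> \<B>" "V \<subseteq> U" "x \<in> V \<or> y \<in> V"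
        using B(3) by metis
      then show "y \<in> ?R" using U(2) y by auto
    qed
    show "?R \<subseteq> topspace X - {x}"
      using B(2) openin_subset by fastforce
  qed
  also have "\<dots> \<in> Sigma02 X"
    using B(1,2)
    by (intro Sigma02_Un Sigma02_countable_UN) (auto intro: Sigma02_open Sigma02_closed)
  finally show ?thesis .
qed

lemma Sigma02_compl_finite:
  assumes "second_countable X" "t0_space X" "finite F" "F \<subseteq> topspace X"
  shows "topspace X - F \<in> Sigma02 X"
  using assms(3,4)
proof (induction F)
  case empty
  then show ?case by (simp add: Sigma02_open)
next
  case (insert x F)
  then have "topspace X - insert x F = (topspace X - {x}) \<inter> (topspace X - F)" by blast
  then show ?case
    using insert Sigma02_compl_singleton[OF assms(1,2)] by (auto intro: Sigma02_Int)
qed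

section \<open>Irreducible sets and generic points\<close>

text \<open>Otherwise \<open>C - U\<close> and \<open>C - V\<close> would be proper closed subsets
  with union \<open>C\<close>.\<close>

lemma irreducible_closedin_Int_open:
  assumes "irreducible_closedin X C" "openin X U" "openin X V" "U \<inter> C \<noteq> {}" "V \<inter> C \<noteq> {}"
  shows "U \<inter> V \<inter> C \<noteq> {}"
proof
  assume "U \<inter> V \<inter> C = {}"
  then have "C = (C - U) \<union> (C - V)" "C - U \<subset> C" "C - V \<subset> C"
    using assms(4,5) by blast+
  moreover have "closedin X (C - U)" "closedin X (C - V)"
    using assms(1-3) unfolding irreducible_closedin_def by (auto intro: closedin_diff)
  ultimately show False
    using assms(1) unfolding irreducible_closedin_def by blast
qed

text \<open>A proper closed subset of the closure cannot contain \<open>A\<close>, so its complement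
  meets \<open>A\<close>. Two such complements share a point of \<open>A\<close>, which then lies in
  neither subset.\<close>

lemma irreducible_closedin_closure_of:
  assumes "A \<subseteq> topspace X" "A \<noteq> {}"
    and meet: "\<And>U V. openin X U \<Longrightarrow> openin X V \<Longrightarrow> U \<inter> A \<noteq> {} \<Longrightarrow> V \<inter> A \<noteq> {} \<Longrightarrow> U \<inter> V \<inter> A \<noteq> {}"
  shows "irreducible_closedin X (X closure_of A)"
  unfolding irreducible_closedin_def
proof (intro conjI notI)
  show "closedin X (X closure_of A)" by simp
  show False if "X closure_of A = {}"
    using that assms(1,2) closure_of_subset by blast
  assume "\<exists>B C. closedin X B \<and> closedin X C \<and> B \<subset> X closure_of A \<and> C \<subset> X closure_of A
    \<and> X closure_of A = B \<union> C"
  then obtain B C where BC: "closedin X B" "closedin X C" "B \<subset> X closure_of A"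
    "C \<subset> X closure_of A" "X closure_of A = B \<union> C"
    by blast
  have "(topspace X - D) \<inter> A \<noteq> {}" if "closedin X D" "D \<subset> X closure_of A" for D
    using that closure_of_minimal[of A D X] assms(1) by blast
  then have "(topspace X - B) \<inter> (topspace X - C) \<inter> A \<noteq> {}"
    using BC meet by (meson openin_diff openin_topspace)
  then show False
    using BC(5) closure_of_subset[OF assms(1)] by blast
qed

text \<open>Sobriety gives a generic point \<open>x\<close> of the closure of \<open>A\<close>, so
  an open set contains \<open>x\<close> iff it meets \<open>A\<close>. Such a point satisfies each
  implication "in \<open>U i\<close> implies in \<open>V i\<close>" that defines \<open>A\<close>:
  if \<open>x\<close> is in \<open>U i\<close>, some point of \<open>A\<close> is in
  \<open>U i\<close>, hence in \<open>V i\<close>, and so \<open>x\<close> is in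
  \<open>V i\<close>.\<close>

lemma sober_Pi02_generic_point:
  assumes "sober_space X" "A \<in> Pi02 X" "A \<noteq> {}"
    and meet: "\<And>U V. openin X U \<Longrightarrow> openin X V \<Longrightarrow> U \<inter> A \<noteq> {} \<Longrightarrow> V \<inter> A \<noteq> {} \<Longrightarrow> U \<inter> V \<inter> A \<noteq> {}"
  obtains x where "x \<in> A" "\<And>U. openin X U \<Longrightarrow> U \<inter> A \<noteq> {} \<Longrightarrow> x \<in> U"
proof -
  obtain S where "A = topspace X - S" and S: "S \<in> Sigma02 X"
    using assms(2) unfolding Pi02_def by blast
  moreover obtain U V where "S = (\<Union>i::nat. U i - V i)"
    and UV: "\<forall>i. openin X (U i)" "\<forall>i. openin X (V i)"
    using S[unfolded Sigma02_iff] by (elim exE conjE)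
  ultimately have A: "A = topspace X - (\<Union>i. U i - V i)" by (simp only:)
  have "irreducible_closedin X (X closure_of A)"
    using A assms(3) meet by (intro irreducible_closedin_closure_of) auto
  then obtain x where x: "x \<in> topspace X" "X closure_of A = X closure_of {x}"
    using assms(1) unfolding sober_space_def by blast
  have generic: "x \<in> W \<longleftrightarrow> W \<inter> A \<noteq> {}" if "openin X W" for W
    using openin_Int_closure_of_eq_empty[OF that, of A] openin_Int_closure_of_eq_empty[OF that, of "{x}"] x(2) by auto
  have "x \<in> V i" if "x \<in> U i" for i
  proof -
    have "U i \<inter> A \<noteq> {}" using generic[OF spec[OF UV(1)], of i] that by simp
    then obtain y where y: "y \<in> U i" "y \<in> A" by blast
    then have "y \<in> V i" by (simp add: A)
    then have "V i \<inter> A \<noteq> {}" using y(2) by blast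
    then show ?thesis using generic[OF spec[OF UV(2)], of i] by simp
  qed
  then have "x \<in> A" unfolding A using x(1) by simp
  then show thesis using that generic by blast
qed

section \<open>Subspaces given by sequences\<close>

text \<open>Expresses a homeomorphism through an injection \<open>a\<close> and open sets of the
  ambient space \<open>X\<close> only. The two conditions on open sets encode continuity of
  \<open>a\<close> and openness of \<open>a\<close> onto its range.\<close>

lemma homeomorphic_space_subtopology_iff:
  assumes "topspace T = UNIV" "A \<subseteq> topspace X"
  shows "subtopology X A homeomorphic_space T \<longleftrightarrow>
    (\<exists>a. inj a \<and> range a = A \<and> (\<forall>U. openin X U \<longrightarrow> openin T (a -` U)) \<and>
      (\<forall>V. openin T V \<longrightarrow> (\<exists>U. openin X U \<and> a -` U = V)))" (is "?L \<longleftrightarrow> (\<exists>a. ?P a)")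
proof -
  have top: "topspace (subtopology X A) = A" using assms(2) by auto
  have *: "homeomorphic_map T (subtopology X A) a \<longleftrightarrow> ?P a" for a
  proof
    assume h: "homeomorphic_map T (subtopology X A) a"
    then have inj: "inj a" and ran: "range a = A" and cont: "continuous_map T (subtopology X A) a"
      and op: "open_map T (subtopology X A) a"
      unfolding homeomorphic_eq_everything_map assms(1) top by auto
    have "openin T (a -` U)" if "openin X U" for U
      using openin_continuous_map_preimage[of T X a U] cont that assms(1)
      by (auto simp: continuous_map_in_subtopology vimage_def)
    moreover have "\<exists>U. openin X U \<and> a -` U = V" if V: "openin T V" for V
    proof -
      obtain U where "openin X U" "a ` V = U \<inter> A"
        using op V unfolding open_map_def openin_subtopology by blast
      then have "a -` U = V"
        using ran inj by (auto dest: injD)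
      then show ?thesis using \<open>openin X U\<close> by blast
    qed
    ultimately show "?P a" using inj ran by blast
  next
    assume P: "?P a"
    then have "continuous_map T X a"
      using assms by (auto simp: continuous_map_def vimage_def)
    then have "continuous_map T (subtopology X A) a"
      using P by (auto simp: continuous_map_in_subtopology)
    moreover have "open_map T (subtopology X A) a"
      unfolding open_map_def
    proof (intro allI impI)
      fix V assume "openin T V"
      then obtain U where U: "openin X U" "a -` U = V" using P by blast
      then have "a ` V = U \<inter> A" using P by blast
      then show "openin (subtopology X A) (a ` V)"
        using U(1) unfolding openin_subtopology by blast
    qed
    ultimately show "homeomorphic_map T (subtopology X A) a"
      using P by (intro bijective_open_imp_homeomorphic_map) (use assms in auto)
  qed
  have "?L \<longleftrightarrow> T homeomorphic_space subtopology X A" by (rule homeomorphic_space_sym)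
  also have "\<dots> \<longleftrightarrow> (\<exists>a. ?P a)" unfolding homeomorphic_space * ..
  finally show ?thesis .
qed

text \<open>Isolates what \<open>SD\<close> and \<open>S1\<close> have in common: non-empty open
  sets always meet, yet no point lies in all of them. The first property passes to \<open>A\<close>
  and forces a generic point \<open>a t\<close> in \<open>A\<close>; then \<open>t\<close> would lie
  in every non-empty open set of \<open>T\<close>.\<close>

lemma sober_Pi02_not_homeomorphic:
  assumes "sober_space X" "A \<in> Pi02 X" "topspace T = UNIV"
    and meet: "\<And>U V. openin T U \<Longrightarrow> openin T V \<Longrightarrow> U \<noteq> {} \<Longrightarrow> V \<noteq> {} \<Longrightarrow> U \<inter> V \<noteq> {}"
    and avoid: "\<And>t. \<exists>V. openin T V \<and> V \<noteq> {} \<and> t \<notin> V"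
  shows "\<not> subtopology X A homeomorphic_space T"
proof
  assume "subtopology X A homeomorphic_space T"
  moreover have "A \<subseteq> topspace X" using assms(2) unfolding Pi02_def by blast
  ultimately obtain a where a: "range a = A" "\<And>U. openin X U \<Longrightarrow> openin T (a -` U)"
    "\<And>V. openin T V \<Longrightarrow> \<exists>U. openin X U \<and> a -` U = V"
    using homeomorphic_space_subtopology_iff[OF assms(3)] by metis
  have "U \<inter> V \<inter> A \<noteq> {}" if "openin X U" "openin X V" "U \<inter> A \<noteq> {}" "V \<inter> A \<noteq> {}" for U V
    using meet[OF a(2)[OF that(1)] a(2)[OF that(2)]] that(3,4) a(1) by blast
  then obtain x where x: "x \<in> A" "\<And>U. openin X U \<Longrightarrow> U \<inter> A \<noteq> {} \<Longrightarrow> x \<in> U"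
    using sober_Pi02_generic_point[OF assms(1,2)] a(1) by blast
  obtain t where t: "x = a t" using x(1) a(1) by blast
  obtain V where V: "openin T V" "V \<noteq> {}" "t \<notin> V" using avoid by blast
  obtain U where "openin X U" "a -` U = V" using a(3)[OF V(1)] by blast
  then show False using x(2)[of U] V t a(1) by blast
qed

section \<open>Irreducible closed sets without generic point\<close>

text \<open>If \<open>C\<close> is not a point closure, the closure of each \<open>x\<close> in
  \<open>C\<close> is a proper subset of \<open>C\<close>, and its complement is the required open
  set.\<close>

lemma not_sober_obtains:
  assumes "t0_space X" "\<not> sober_space X"
  obtains C where "irreducible_closedin X C"
    "\<And>x. x \<in> C \<Longrightarrow> \<exists>U. openin X U \<and> U \<inter> C \<noteq> {} \<and> x \<notin> U"
proof -
  obtain C where C: "irreducible_closedin X C"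
    and no: "\<not> (\<exists>!x. x \<in> topspace X \<and> C = X closure_of {x})"
    using assms(2) unfolding sober_space_def by blast
  \<comment> \<open>Points of a T0 space with equal closures coincide, so when unique existence of a
    generic point fails, existence itself fails.\<close>
  have eq: "x = y" if "x \<in> topspace X" "y \<in> topspace X" "X closure_of {x} = X closure_of {y}" for x y
  proof (rule ccontr)
    assume "x \<noteq> y"
    then obtain U where "openin X U" "x \<notin> U \<longleftrightarrow> y \<in> U"
      using assms(1) \<open>x \<in> topspace X\<close> \<open>y \<in> topspace X\<close> unfolding t0_space_def by blast
    then show False
      using openin_Int_closure_of_eq_empty[of X U "{x}"] openin_Int_closure_of_eq_empty[of X U "{y}"] that(3) by auto
  qed
  have ne: "C \<noteq> X closure_of {x}" if "x \<in> topspace X" for x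
    using no eq that by metis
  have cl: "closedin X C" using C unfolding irreducible_closedin_def by blast
  have "\<exists>U. openin X U \<and> U \<inter> C \<noteq> {} \<and> x \<notin> U" if "x \<in> C" for x
  proof -
    have "x \<in> topspace X" using that closedin_subset[OF cl] by blast
    moreover have "X closure_of {x} \<subseteq> C" using that cl by (simp add: closure_of_minimal)
    ultimately obtain y where "y \<in> C" "y \<notin> X closure_of {x}" using ne by blast
    moreover have "x \<in> X closure_of {x}"
      using closure_of_subset[of "{x}" X] \<open>x \<in> topspace X\<close> by simp
    ultimately show ?thesis
      using closedin_subset[OF cl]
      by (intro exI[of _ "topspace X - X closure_of {x}"]) auto
  qed
  then show thesis using that C by blast
qed

text \<open>The last condition says that \<open>A\<close> converges, along its cofinite filter, to every point of \<open>C\<close>.\<close>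

definition almost_generic :: "'a topology \<Rightarrow> 'a set \<Rightarrow> 'a set \<Rightarrow> bool" where
  "almost_generic X C A \<longleftrightarrow>
     A \<subseteq> C \<and> infinite A \<and> (\<forall>U. openin X U \<longrightarrow> U \<inter> C \<noteq> {} \<longrightarrow> finite (A - U))"

text \<open>Needed because Ramsey's theorem and the later choices only deliver an infinite subset of
  the given set.\<close>

lemma almost_generic_subset:
  assumes "almost_generic X C A" "B \<subseteq> A" "infinite B"
  shows "almost_generic X C B"
proof -
  have "B - U \<subseteq> A - U" for U using assms(2) by blast
  then have "finite (B - U)" if "openin X U" "U \<inter> C \<noteq> {}" for U
    using assms(1) that finite_subset[of "B - U" "A - U"] unfolding almost_generic_def by simp
  then show ?thesis using assms unfolding almost_generic_def by auto
qed

text \<open>Enumerate the basic open sets meeting \<open>C\<close> as \<open>w\<close> and pick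
  \<open>x n\<close> in \<open>C\<close> and in the first \<open>n + 1\<close> of them, which is
  possible by irreducibility. Every open set meeting \<open>C\<close> includes some
  \<open>w i\<close> and therefore a tail of \<open>x\<close>.\<close>

lemma almost_generic_exists:
  assumes "second_countable X" "irreducible_closedin X C"
    and avoid: "\<And>x. x \<in> C \<Longrightarrow> \<exists>U. openin X U \<and> U \<inter> C \<noteq> {} \<and> x \<notin> U"
  obtains A where "almost_generic X C A"
proof -
  obtain \<B> where "countable \<B> \<and> (\<forall>V\<in>\<B>. openin X V) \<and>
      (\<forall>U y. openin X U \<and> y \<in> U \<longrightarrow> (\<exists>V\<in>\<B>. y \<in> V \<and> V \<subseteq> U))"
    using assms(1) unfolding second_countable_def by (elim exE)
  then have B: "countable \<B>" "\<And>V. V \<in> \<B> \<Longrightarrow> openin X V"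
    "\<And>U y. openin X U \<Longrightarrow> y \<in> U \<Longrightarrow> \<exists>V\<in>\<B>. y \<in> V \<and> V \<subseteq> U"
    by simp_all
  have C: "C \<noteq> {}" using assms(2) unfolding irreducible_closedin_def by blast
  define \<W> where "\<W> = {V\<in>\<B>. V \<inter> C \<noteq> {}}"
  have below: "\<exists>V\<in>\<W>. V \<subseteq> U" if "openin X U" "U \<inter> C \<noteq> {}" for U
    using that B(3) unfolding \<W>_def by blast
  have "countable \<W>" using B(1) unfolding \<W>_def by simp
  moreover have "\<W> \<noteq> {}"
  proof -
    obtain x where "x \<in> C" using C by blast
    then obtain U where "openin X U" "U \<inter> C \<noteq> {}" using avoid by blast
    then show ?thesis using below by blast
  qed
  ultimately have W: "countable \<W>" "\<W> \<noteq> {}" .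
  define w where "w = from_nat_into \<W>"
  have w: "range w = \<W>" unfolding w_def by (rule range_from_nat_into[OF W(2,1)])
  have w_open: "openin X (w n)" and w_meets: "w n \<inter> C \<noteq> {}" for n
  proof -
    have "w n \<in> \<W>" using w by blast
    then show "openin X (w n)" "w n \<inter> C \<noteq> {}" using B(2) unfolding \<W>_def by auto
  qed
  have ne: "openin X (\<Inter>i\<le>n. w i) \<and> (\<Inter>i\<le>n. w i) \<inter> C \<noteq> {}" for n
  proof (induction n)
    case 0
    then show ?case using w_open w_meets by simp
  next
    case (Suc n)
    then show ?case
      using irreducible_closedin_Int_open[OF assms(2), of "w (Suc n)" "\<Inter>i\<le>n. w i"] w_open w_meets
      by (auto simp: atMost_Suc)
  qed
  then have "\<forall>n. \<exists>y. y \<in> (\<Inter>i\<le>n. w i) \<inter> C" by blast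
  from choice[OF this] obtain x where "\<forall>n. x n \<in> (\<Inter>i\<le>n. w i) \<inter> C" by (elim exE)
  then have x: "x n \<in> (\<Inter>i\<le>n. w i) \<inter> C" for n by (rule spec)
  have tail: "\<exists>N. \<forall>n\<ge>N. x n \<in> U" if "openin X U" "U \<inter> C \<noteq> {}" for U
  proof -
    obtain V where "V \<in> range w" "V \<subseteq> U" using w below[OF \<open>openin X U\<close> \<open>U \<inter> C \<noteq> {}\<close>] by blast
    then obtain i where "w i \<subseteq> U" by blast
    then show ?thesis using x by (intro exI[of _ i]) blast
  qed
  have "finite (range x - U)" if "openin X U" "U \<inter> C \<noteq> {}" for U
  proof -
    obtain N where "\<forall>n\<ge>N. x n \<in> U" using tail[OF \<open>openin X U\<close> \<open>U \<inter> C \<noteq> {}\<close>] by blast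
    then have "range x - U \<subseteq> x ` {..<N}" using not_le by blast
    then show ?thesis using finite_surj by blast
  qed
  moreover have "infinite (range x)"
  proof
    assume "finite (range x)"
    \<comment> \<open>A value taken infinitely often would lie in every open set that meets
      \<open>C\<close>, contrary to \<open>avoid\<close>.\<close>
    then obtain m where m: "infinite {n. x n = x m}"
      using pigeonhole_infinite[of "UNIV :: nat set" x] by auto
    have "x m \<in> C" using x[of m] by simp
    then obtain U where U: "openin X U" "U \<inter> C \<noteq> {}" "x m \<notin> U" using avoid by blast
    obtain N where N: "\<forall>n\<ge>N. x n \<in> U" using tail[OF U(1,2)] by blast
    have "n < N" if "x n = x m" for n
      using N U(3) that by (metis not_le)
    then have "{n. x n = x m} \<subseteq> {..<N}" by auto
    then show False using m finite_subset by blast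
  qed
  moreover have "range x \<subseteq> C" using x by blast
  ultimately show thesis using that unfolding almost_generic_def by blast
qed

text \<open>A point of \<open>C\<close> outside \<open>A\<close> misses some basic open
  \<open>V\<close> meeting \<open>C\<close>. Only finitely many points of \<open>A\<close> miss
  \<open>V\<close>, and the complement of a finite set is in \<open>Sigma02 X\<close>; so the
  complement of \<open>A\<close> is a countable union of sets in \<open>Sigma02 X\<close>.\<close>

lemma almost_generic_Pi02:
  assumes "second_countable X" "t0_space X" "closedin X C" "almost_generic X C A"
    and avoid: "\<And>x. x \<in> C \<Longrightarrow> \<exists>U. openin X U \<and> U \<inter> C \<noteq> {} \<and> x \<notin> U"
  shows "A \<in> Pi02 X"
proof -
  obtain \<B> where "countable \<B> \<and> (\<forall>V\<in>\<B>. openin X V) \<and>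
      (\<forall>U y. openin X U \<and> y \<in> U \<longrightarrow> (\<exists>V\<in>\<B>. y \<in> V \<and> V \<subseteq> U))"
    using assms(1) unfolding second_countable_def by (elim exE)
  then have B: "countable \<B>" "\<And>V. V \<in> \<B> \<Longrightarrow> openin X V"
    "\<And>U y. openin X U \<Longrightarrow> y \<in> U \<Longrightarrow> \<exists>V\<in>\<B>. y \<in> V \<and> V \<subseteq> U"
    by simp_all
  have A: "A \<subseteq> C" "A \<subseteq> topspace X"
    using assms(3,4) closedin_subset unfolding almost_generic_def by blast+
  define \<W> where "\<W> = {V\<in>\<B>. V \<inter> C \<noteq> {}}"
  \<comment> \<open>Outside \<open>V\<close>, removing the finite set \<open>A - V\<close> is the
    same as removing all of \<open>A\<close>.\<close>
  define S where "S = (topspace X - C) \<union> (\<Union>V\<in>\<W>. (topspace X - V) \<inter> (topspace X - (A - V)))"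
  have "topspace X - A \<subseteq> S"
  proof
    fix y assume y: "y \<in> topspace X - A"
    show "y \<in> S"
    proof (cases "y \<in> C")
      case True
      then obtain U where U: "openin X U" "U \<inter> C \<noteq> {}" "y \<notin> U" using avoid by blast
      then obtain V where "V \<in> \<W>" "V \<subseteq> U" using B(3) unfolding \<W>_def by blast
      then show ?thesis using y U(3) unfolding S_def by blast
    qed (use y in \<open>simp add: S_def\<close>)
  qed
  moreover have "S \<subseteq> topspace X - A" using A(1) unfolding S_def by blast
  moreover have "S \<in> Sigma02 X"
    unfolding S_def
  proof (intro Sigma02_Un Sigma02_countable_UN Sigma02_Int)
    show "topspace X - C \<in> Sigma02 X" using assms(3) by (auto intro: Sigma02_open)
    show "countable \<W>" using B(1) unfolding \<W>_def by simp
    fix V assume "V \<in> \<W>"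
    then have V: "openin X V" "V \<inter> C \<noteq> {}" using B(2) unfolding \<W>_def by auto
    then show "topspace X - V \<in> Sigma02 X" by (auto intro: Sigma02_closed)
    have "finite (A - V)" using assms(4) V unfolding almost_generic_def by blast
    then show "topspace X - (A - V) \<in> Sigma02 X"
      using A(2) by (intro Sigma02_compl_finite[OF assms(1,2)]) auto
  qed
  ultimately have "topspace X - A \<in> Sigma02 X" by (metis subset_antisym)
  moreover have "A = topspace X - (topspace X - A)" using A(2) by blast
  ultimately show ?thesis unfolding Pi02_def by blast
qed

section \<open>Chains and antichains of the specialization order\<close>

text \<open>With \<open>x\<close> below \<open>y\<close> meaning that \<open>x\<close> lies in the
  closure of \<open>y\<close>, the sequence is strictly increasing. Open sets are upward closed, so
  they cut out final segments of indices; conversely, complements of point closures give all proper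
  final segments.\<close>

lemma chain_homeomorphic_SD:
  assumes top: "range a \<subseteq> topspace X"
    and up: "\<And>n. a n \<in> X closure_of {a (Suc n)}"
    and strict: "\<And>n. a (Suc n) \<notin> X closure_of {a n}"
  shows "subtopology X (range a) homeomorphic_space SD"
proof -
  have trans: "X closure_of {x} \<subseteq> X closure_of {y}" if "x \<in> X closure_of {y}" for x y
    using that by (simp add: closure_of_minimal)
  have mono: "X closure_of {a m} \<subseteq> X closure_of {a n}" if "m \<le> n" for m n
    using lift_Suc_mono_le[of "\<lambda>n. X closure_of {a n}"] trans[OF up] that by blast
  have self: "a n \<in> X closure_of {a n}" for n
    using closure_of_subset[of "{a n}" X] top by auto
  have le_iff: "a m \<in> X closure_of {a n} \<longleftrightarrow> m \<le> n" for m n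
  proof
    assume "a m \<in> X closure_of {a n}"
    then show "m \<le> n"
      using strict[of n] mono[of "Suc n" m] trans self by (meson not_less_eq_eq subsetD)
  qed (use mono self in blast)
  have "inj a"
    by (rule injI) (metis le_iff order_antisym order_refl)
  moreover have "openin SD (a -` U)" if "openin X U" for U
  proof (cases "a -` U = {}")
    case False
    then have least: "a (LEAST n. a n \<in> U) \<in> U" by (metis LeastI equals0I vimageE)
    have "a n \<in> U" if "m \<le> n" "a m \<in> U" for m n
      using openin_Int_closure_of_eq_empty[OF \<open>openin X U\<close>, of "{a n}"] le_iff that by blast
    then have "a -` U = {n. (LEAST n. a n \<in> U) \<le> n}"
      using least by (auto intro: Least_le)
    then show ?thesis unfolding openin_SD by blast
  qed (simp add: openin_SD)
  moreover have "\<exists>U. openin X U \<and> a -` U = V" if "openin SD V" for V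
  proof (cases "V = {}")
    case False
    then have "\<exists>n. V = {m. n \<le> m}" using that by (simp only: openin_SD simp_thms)
    then obtain n where V: "V = {m. n \<le> m}" by (elim exE)
    show ?thesis
    proof (cases n)
      case 0
      then show ?thesis using V top by (intro exI[of _ "topspace X"]) auto
    next
      \<comment> \<open>The closure of \<open>a k\<close> contains exactly the terms with index at
        most \<open>k\<close>, so its complement leaves those from \<open>Suc k = n\<close>
        on.\<close>
      case (Suc k)
      then show ?thesis
        using V le_iff range_subsetD[OF top]
        by (intro exI[of _ "topspace X - X closure_of {a k}"]) auto
    qed
  qed (intro exI[of _ "{}"], simp)
  ultimately show ?thesis
    unfolding homeomorphic_space_subtopology_iff[OF topspace_SD top] by blast
qed

text \<open>Almost genericity makes the trace of an open set empty or cofinite. Conversely, each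
  point closure contains just one term of the antichain, so removing finitely many closures realizes
  any cofinite set of indices.\<close>

lemma antichain_homeomorphic_S1:
  fixes a :: "nat \<Rightarrow> 'a"
  assumes top: "range a \<subseteq> topspace X" and gen: "almost_generic X C (range a)" and "inj a"
    and anti: "\<And>m n. a m \<in> X closure_of {a n} \<Longrightarrow> m = n"
  shows "subtopology X (range a) homeomorphic_space S1"
proof -
  have self: "a n \<in> X closure_of {a n}" for n
    using closure_of_subset[of "{a n}" X] top by auto
  have "openin S1 (a -` U)" if "openin X U" for U
  proof (cases "U \<inter> C = {}")
    case True
    then show ?thesis using gen unfolding almost_generic_def openin_S1 by blast
  next
    case False
    then have "finite (range a - U)" using gen that unfolding almost_generic_def by blast
    then have "finite (a -` (range a - U))" using \<open>inj a\<close> by (rule finite_vimageI)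
    moreover have "a -` (range a - U) = - (a -` U)" by blast
    ultimately show ?thesis by (simp add: openin_S1)
  qed
  moreover have "\<exists>U. openin X U \<and> a -` U = V" if "openin S1 V" for V
  proof (cases "V = {}")
    case False
    let ?D = "\<Union>k\<in>- V. X closure_of {a k}"
    have "finite (- V)" using that False unfolding openin_S1 by blast
    then have "closedin X ?D" by (intro closedin_Union) auto
    moreover have "a -` (topspace X - ?D) = V" using top anti self by blast
    ultimately show ?thesis by blast
  qed (intro exI[of _ "{}"], simp)
  ultimately show ?thesis
    unfolding homeomorphic_space_subtopology_iff[OF topspace_S1 top] using \<open>inj a\<close> by blast
qed

lemma almost_generic_contains_SD_or_S1:
  assumes "closedin X C" "almost_generic X C A"
    and avoid: "\<And>x. x \<in> C \<Longrightarrow> \<exists>U. openin X U \<and> U \<inter> C \<noteq> {} \<and> x \<notin> U"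
  obtains B where "B \<subseteq> A" "infinite B"
    "subtopology X B homeomorphic_space SD \<or> subtopology X B homeomorphic_space S1"
proof -
  \<comment> \<open>Colours a two-element set by comparability in the specialization order: 0 for
    comparable, 1 for incomparable.\<close>
  define f :: "'a set \<Rightarrow> nat" where
    "f S = (if \<exists>x\<in>S. \<exists>y\<in>S. x \<noteq> y \<and> x \<in> X closure_of {y} then 0 else 1)" for S
  have A: "A \<subseteq> C" "A \<subseteq> topspace X" "infinite A"
    using assms(1,2) closedin_subset unfolding almost_generic_def by blast+
  have "\<forall>x\<in>A. \<forall>y\<in>A. x \<noteq> y \<longrightarrow> f {x, y} < 2" unfolding f_def by simp
  then obtain Y t where Y: "Y \<subseteq> A" "infinite Y" "t < 2"
    and t: "\<And>x y. x \<in> Y \<Longrightarrow> y \<in> Y \<Longrightarrow> x \<noteq> y \<Longrightarrow> f {x, y} = t"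
    using Ramsey2[OF A(3), of f 2] by metis
  show thesis
  proof (cases "t = 0")
    case True
    have comparable: "x \<in> X closure_of {y} \<or> y \<in> X closure_of {x}"
      if "x \<in> Y" "y \<in> Y" "x \<noteq> y" for x y
      using t[OF that] True that unfolding f_def by (auto split: if_splits)
    \<comment> \<open>No point of \<open>Y\<close> is maximal: an open set that meets
      \<open>C\<close> but misses \<open>x\<close> contains almost all of \<open>Y\<close>. Any
      \<open>y\<close> of \<open>Y\<close> in it is not below \<open>x\<close>, hence above it by
      comparability. This drives the dependent choice of an increasing sequence.\<close>
    have succ: "\<exists>y\<in>Y. x \<in> X closure_of {y} \<and> y \<notin> X closure_of {x}" if "x \<in> Y" for x
    proof -
      have "x \<in> C" using that Y(1) A(1) by blast
      then obtain U where U: "openin X U" "U \<inter> C \<noteq> {}" "x \<notin> U" using avoid by blast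
      then have "finite (Y - U)"
        using almost_generic_subset[OF assms(2) Y(1,2)] unfolding almost_generic_def by blast
      then obtain y where y: "y \<in> Y" "y \<in> U" using Y(2) by (metis DiffI finite_subset subsetI)
      then have "y \<notin> X closure_of {x}" using openin_Int_closure_of_eq_empty[OF U(1), of "{x}"] U(3) by blast
      then show ?thesis using comparable[OF that y(1)] y U(3) by blast
    qed
    have "\<exists>y. y \<in> Y" using Y(2) by (metis equals0I finite.emptyI)
    then obtain a where a: "\<And>n. a n \<in> Y"
      "\<And>n. a n \<in> X closure_of {a (Suc n)} \<and> a (Suc n) \<notin> X closure_of {a n}"
      using dependent_nat_choice[of "\<lambda>_ x. x \<in> Y"
        "\<lambda>_ x y. x \<in> X closure_of {y} \<and> y \<notin> X closure_of {x}"] succ by metis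
    have sub: "range a \<subseteq> topspace X" using a(1) Y(1) A(2) by blast
    have SD: "subtopology X (range a) homeomorphic_space SD"
      using chain_homeomorphic_SD[OF sub] a(2) by blast
    \<comment> \<open>The homeomorphism with \<open>SD\<close> yields an injective enumeration of
      the chain, so its range is infinite.\<close>
    then obtain b :: "nat \<Rightarrow> 'a" where "inj b" "range b = range a"
      unfolding homeomorphic_space_subtopology_iff[OF topspace_SD sub] by blast
    then have "infinite (range a)" using range_inj_infinite by metis
    then show thesis using that[of "range a"] a(1) Y(1) SD by blast
  next
    case False
    obtain a :: "nat \<Rightarrow> 'a" where a: "inj a" "range a \<subseteq> Y"
      using infinite_countable_subset[OF Y(2)] by blast
    have inf: "infinite (range a)" using range_inj_infinite[OF a(1)] .
    have sub: "range a \<subseteq> A" "range a \<subseteq> topspace X" using a(2) Y(1) A(2) by blast+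
    have "m = n" if "a m \<in> X closure_of {a n}" for m n
    proof (rule ccontr)
      assume "m \<noteq> n"
      then have "a m \<noteq> a n" using a(1) by (auto dest: injD)
      then have "f {a m, a n} = 0" using that unfolding f_def by auto
      then show False using t[of "a m" "a n"] a(2) \<open>a m \<noteq> a n\<close> False by auto
    qed
    then have "subtopology X (range a) homeomorphic_space S1"
      by (rule antichain_homeomorphic_S1[OF sub(2) almost_generic_subset[OF assms(2) sub(1) inf] a(1)])
    then show thesis using that[OF sub(1) inf] by blast
  qed
qed

theorem theorem4p3:
  fixes X :: "'a topology"
  assumes "second_countable X" and "t0_space X"
  shows "sober_space X \<longleftrightarrow>
    \<not> (\<exists>A \<in> Pi02 X. subtopology X A homeomorphic_space SD \<or>
                     subtopology X A homeomorphic_space S1)"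
proof
  assume sober: "sober_space X"
  have "\<not> subtopology X A homeomorphic_space SD" if "A \<in> Pi02 X" for A
  proof (rule sober_Pi02_not_homeomorphic[OF sober that topspace_SD])
    fix U V assume "openin SD U" "openin SD V" "U \<noteq> {}" "V \<noteq> {}"
    then obtain m n where "U = {k. m \<le> k}" "V = {k. n \<le> k}" unfolding openin_SD by blast
    then have "max m n \<in> U \<inter> V" by simp
    then show "U \<inter> V \<noteq> {}" by blast
  next
    fix n
    \<comment> \<open>The final segment starting just after \<open>n\<close> is a non-empty open set
      missing \<open>n\<close>.\<close>
    have "openin SD {k. Suc n \<le> k}" unfolding openin_SD by blast
    then show "\<exists>V. openin SD V \<and> V \<noteq> {} \<and> n \<notin> V"
      by (intro exI[of _ "{k. Suc n \<le> k}"]) auto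
  qed
  moreover have "\<not> subtopology X A homeomorphic_space S1" if "A \<in> Pi02 X" for A
  proof (rule sober_Pi02_not_homeomorphic[OF sober that topspace_S1])
    fix U V assume "openin S1 U" "openin S1 V" "U \<noteq> {}" "V \<noteq> {}"
    then have "finite (- U \<union> - V)" unfolding openin_S1 by simp
    \<comment> \<open>Two finite complements cannot cover the natural numbers, so a point common to
      \<open>U\<close> and \<open>V\<close> remains.\<close>
    then have "- U \<union> - V \<noteq> UNIV" by (metis infinite_UNIV_nat)
    then show "U \<inter> V \<noteq> {}" by blast
  next
    fix n :: nat
    have "- {n} \<noteq> {}" by (metis ComplI empty_iff n_not_Suc_n singletonD)
    then show "\<exists>V. openin S1 V \<and> V \<noteq> {} \<and> n \<notin> V"
      by (intro exI[of _ "- {n}"]) (simp add: openin_S1)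
  qed
  ultimately show "\<not> (\<exists>A \<in> Pi02 X. subtopology X A homeomorphic_space SD \<or>
      subtopology X A homeomorphic_space S1)"
    by blast
next
  assume none: "\<not> (\<exists>A \<in> Pi02 X. subtopology X A homeomorphic_space SD \<or>
      subtopology X A homeomorphic_space S1)"
  show "sober_space X"
  proof (rule ccontr)
    assume "\<not> sober_space X"
    then obtain C where C: "irreducible_closedin X C"
      and avoid: "\<And>x. x \<in> C \<Longrightarrow> \<exists>U. openin X U \<and> U \<inter> C \<noteq> {} \<and> x \<notin> U"
      using not_sober_obtains[OF assms(2)] by blast
    have cl: "closedin X C" using C unfolding irreducible_closedin_def by blast
    obtain A where A: "almost_generic X C A"
      using almost_generic_exists[OF assms(1) C avoid] by blast
    obtain B where B: "B \<subseteq> A" "infinite B"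
      "subtopology X B homeomorphic_space SD \<or> subtopology X B homeomorphic_space S1"
      using almost_generic_contains_SD_or_S1[OF cl A avoid] by blast
    \<comment> \<open>\<open>B\<close> inherits almost genericity from \<open>A\<close>, so it is in
      \<open>Pi02 X\<close> however it was extracted by Ramsey's theorem.\<close>
    have "B \<in> Pi02 X"
      using almost_generic_Pi02[OF assms cl almost_generic_subset[OF A B(1,2)] avoid] .
    then show False using none B(3) by blast
  qed
qed

end
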